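(* Let $f:\mathbb{R}^d\to\mathbb{R}$, let $g:\mathbb{R}^d\to\mathbb{R}$ be an upper semicontinuous function, and let $f^{\wedge g}:\mathbb{R}\to\overline{\mathbb{R}}$ be defined by $f^{\wedge g}(s)=\inf\{f(x) : x\in\mathbb{R}^d,\ s\le g(x)\}$. Assume that: 1. if $\sup_{\mathbb{R}^d} g<+\infty$, there exists $x\in\mathbb{R}^d$ such that $g(x)=\sup_{\mathbb{R}^d} g$; 2. there exists a set-valued map $C:\mathbb{R}\rightrightarrows\mathbb{R}^d$ with compact values such that for all real $s>\inf_{\mathbb{R}^d} g$ and all $t\in\mathbb{R}\cap[s,\sup_{\mathbb{R}^d} g]$, $$f^{\wedge g}(s)=\inf\{f(x) : x\in C(t),\ s\le g(x)\};$$ 3. $f$ is lower semicontinuous. Then $f^{\wedge g}$ is lower semicontinuous.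
   Context: $\overline{\mathbb{R}}=\mathbb{R}\cup\{-\infty,+\infty\}$; the infimum over the empty set is $+\infty$. A set-valued map $C:\mathbb{R}\rightrightarrows\mathbb{R}^d$ associates to each $t\in\mathbb{R}$ a (possibly empty) subset $C(t)\subseteq\mathbb{R}^d$. An extended-real-valued function $h$ is lower (resp. upper) semicontinuous if for every point $x$ and every sequence $x_k\to x$, $\liminf_k h(x_k)\ge h(x)$ (resp. $\limsup_k h(x_k)\le h(x)$). *)

theory Defs
  imports "HOL-Analysis.Analysis"
begin

text \<open>Semicontinuity is taken in its sequential form, with \<open>liminf\<close> and \<open>limsup\<close> in the
  extended reals; a real-valued \<open>f\<close> is used as \<open>\<lambda>x. ereal (f x)\<close>.\<close>

definition lower_semicontinuous :: "('a::metric_space \<Rightarrow> ereal) \<Rightarrow> bool" where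
  "lower_semicontinuous h \<longleftrightarrow>
    (\<forall>x X. X \<longlonglongrightarrow> x \<longrightarrow> h x \<le> liminf (\<lambda>k. h (X k)))"

definition upper_semicontinuous :: "('a::metric_space \<Rightarrow> ereal) \<Rightarrow> bool" where
  "upper_semicontinuous h \<longleftrightarrow>
    (\<forall>x X. X \<longlonglongrightarrow> x \<longrightarrow> limsup (\<lambda>k. h (X k)) \<le> h x)"

text \<open>The function \<open>s \<mapsto> inf {f x | s \<le> g x}\<close>, written \<open>f\<^sup>\<and>\<^sup>g\<close>. The infimum is taken in \<open>ereal\<close>,
  so it is \<open>\<infinity>\<close> when no \<open>x\<close> satisfies the constraint and \<open>-\<infinity>\<close> when \<open>f\<close> is unbounded below.\<close>

definition constrained_inf :: "('a \<Rightarrow> real) \<Rightarrow> ('a \<Rightarrow> real) \<Rightarrow> real \<Rightarrow> ereal" where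
  "constrained_inf f g s = (INF x\<in>{x. s \<le> g x}. ereal (f x))"

end

theory Submission
  imports Defs
begin

text \<open>The constrained infimum is nondecreasing in \<open>s\<close>, so only sequences approaching \<open>s\<close> from below
  matter, and it is constant for \<open>s \<le> inf g\<close> and infinite for \<open>s > sup g\<close>. In between, the
  constraint set \<open>C s\<close> may be used for all levels in \<open>(inf g, s]\<close> at once. Near-minimizers at levels
  tending to \<open>s\<close> then lie in one compact set, and any cluster point of theirs is feasible at level
  \<open>s\<close> since \<open>g\<close> is upper semicontinuous, with small \<open>f\<close> since \<open>f\<close> is lower semicontinuous.\<close>

lemma constrained_inf_mono: "s \<le> t \<Longrightarrow> constrained_inf f g s \<le> constrained_inf f g t"
  unfolding constrained_inf_def by (rule INF_superset_mono) auto

text \<open>At level \<open>s\<close> every point is feasible, so the infimum runs over the whole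
  space and is a lower bound for the value at any level \<open>t\<close>, even one below
  \<open>s\<close>.\<close>

lemma constrained_inf_below_Inf:
  assumes "ereal s \<le> (INF x. ereal (g x))"
  shows "constrained_inf f g s \<le> constrained_inf f g t"
proof -
  have "s \<le> g x" for x
    using assms by (auto simp: le_INF_iff)
  then show ?thesis
    unfolding constrained_inf_def by (intro INF_superset_mono) auto
qed

lemma constrained_inf_above_Sup:
  assumes "(SUP x. ereal (g x)) < ereal s"
  shows "constrained_inf f g s = \<infinity>"
proof -
  have "g x < s" for x
    using le_less_trans[OF SUP_upper[of x UNIV "\<lambda>x. ereal (g x)"] assms] by simp
  then have "{x. s \<le> g x} = {}"
    by (auto simp: not_le)
  then show ?thesis
    by (simp add: constrained_inf_def top_ereal_def)
qed

text \<open>The levels \<open>y n\<close> vary, so feasibility is carried to the limit by comparing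
  the limsup of the levels with that of the values of \<open>g\<close>. The bounds on
  \<open>g\<close> and \<open>f\<close> are non-strict, hence survive the limit.\<close>

lemma exists_feasible_limit:
  fixes f g :: "'a::metric_space \<Rightarrow> real"
  assumes usc: "upper_semicontinuous (\<lambda>x. ereal (g x))"
    and lsc: "lower_semicontinuous (\<lambda>x. ereal (f x))"
    and "compact K" and "y \<longlonglongrightarrow> s"
    and x: "\<And>n. x n \<in> K" "\<And>n. y n \<le> g (x n)" "\<And>n. ereal (f (x n)) \<le> c"
  obtains l where "l \<in> K" "s \<le> g l" "ereal (f l) \<le> c"
proof -
  obtain l r where l: "l \<in> K" "strict_mono r" "(x \<circ> r) \<longlonglongrightarrow> l"
    using \<open>compact K\<close> x(1) unfolding compact_def by metis
  have "(\<lambda>n. ereal ((y \<circ> r) n)) \<longlonglongrightarrow> ereal s"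
    using LIMSEQ_subseq_LIMSEQ[OF \<open>y \<longlonglongrightarrow> s\<close> l(2)] by (rule tendsto_ereal)
  then have "ereal s = limsup (\<lambda>n. ereal ((y \<circ> r) n))"
    by (simp only: lim_imp_Limsup[OF sequentially_bot])
  also have "\<dots> \<le> limsup (\<lambda>n. ereal (g ((x \<circ> r) n)))"
    by (rule Limsup_mono) (simp add: x(2))
  also have "\<dots> \<le> ereal (g l)"
    using usc l(3) unfolding upper_semicontinuous_def by blast
  finally have "s \<le> g l" by simp
  have "ereal (f l) \<le> liminf (\<lambda>n. ereal (f ((x \<circ> r) n)))"
    using lsc l(3) unfolding lower_semicontinuous_def by blast
  also have "\<dots> \<le> limsup (\<lambda>n. ereal (f ((x \<circ> r) n)))"
    by (rule Liminf_le_Limsup) simp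
  also have "\<dots> \<le> c"
    by (rule Limsup_bounded) (simp add: x(3))
  finally show thesis
    using that l(1) \<open>s \<le> g l\<close> by blast
qed

text \<open>A single \<open>K\<close> for all levels in \<open>(a, s]\<close> lets near-minimizers
  at different levels share a cluster point. The bound \<open>a\<close> is extended real because it
  will be the infimum of \<open>g\<close>, possibly \<open>-\<infinity>\<close>.\<close>

lemma constrained_inf_le_liminf:
  fixes f g :: "'a::metric_space \<Rightarrow> real"
  assumes usc: "upper_semicontinuous (\<lambda>x. ereal (g x))"
    and lsc: "lower_semicontinuous (\<lambda>x. ereal (f x))"
    and "compact K" and "X \<longlonglongrightarrow> s" and "a < ereal s"
    and K: "\<And>t. a < ereal t \<Longrightarrow> t \<le> s \<Longrightarrow>
      constrained_inf f g t = (INF x\<in>{x \<in> K. t \<le> g x}. ereal (f x))"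
  shows "constrained_inf f g s \<le> liminf (\<lambda>k. constrained_inf f g (X k))"
proof (rule ccontr)
  let ?F = "constrained_inf f g"
  assume "\<not> ?thesis"
  \<comment> \<open>Strictness on the left yields points of \<open>K\<close> with \<open>f\<close>
    below \<open>c\<close>; strictness on the right contradicts the weak bound \<open>c\<close> that
    remains in the limit.\<close>
  then obtain c where c: "liminf (\<lambda>k. ?F (X k)) < c" "c < ?F s"
    using dense by (auto simp: not_le)
  have freq: "\<exists>\<^sub>F k in sequentially. ?F (X k) < c"
  proof (rule ccontr)
    assume "\<not> ?thesis"
    then have "\<forall>\<^sub>F k in sequentially. c \<le> ?F (X k)"
      by (simp add: not_frequently not_less)
    then have "c \<le> liminf (\<lambda>k. ?F (X k))"
      by (rule Liminf_bounded)
    with c(1) show False by simp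
  qed
  \<comment> \<open>Values below \<open>c\<close> are only known to occur frequently, so a level
    within \<open>1/(n+1)\<close> of \<open>s\<close> is picked for each \<open>n\<close>. The
    indices \<open>k\<close> need not increase with \<open>n\<close>: only convergence of the levels
    matters.\<close>
  have "\<exists>y x. x \<in> K \<and> y \<le> g x \<and> ereal (f x) \<le> c \<and> dist y s < inverse (real (Suc n))" for n
  proof -
    have "\<forall>\<^sub>F k in sequentially. dist (X k) s < inverse (real (Suc n))"
      using \<open>X \<longlonglongrightarrow> s\<close> by (rule tendstoD) simp
    moreover have "\<forall>\<^sub>F k in sequentially. a < ereal (X k)"
      using tendsto_ereal[OF \<open>X \<longlonglongrightarrow> s\<close>] \<open>a < ereal s\<close> by (rule order_tendstoD(1))
    ultimately have "\<exists>\<^sub>F k in sequentially.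
        (dist (X k) s < inverse (real (Suc n)) \<and> a < ereal (X k)) \<and> ?F (X k) < c"
      by (intro frequently_eventually_conj[OF freq] eventually_conj)
    then obtain k where k: "?F (X k) < c" "dist (X k) s < inverse (real (Suc n))" "a < ereal (X k)"
      by (auto dest: frequently_ex)
    \<comment> \<open>A level above \<open>s\<close> would have value at least \<open>?F s\<close>,
      which exceeds \<open>c\<close>. This brings \<open>X k\<close> into the range where
      \<open>K\<close> may be used.\<close>
    have "X k \<le> s"
    proof (rule ccontr)
      assume "\<not> X k \<le> s"
      then have "?F s \<le> ?F (X k)"
        by (intro constrained_inf_mono) simp
      then show False
        using k(1) c(2) by (meson leD less_trans)
    qed
    then obtain x where "x \<in> K" "X k \<le> g x" "ereal (f x) < c"
      using k K by (auto simp: INF_less_iff)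
    then show ?thesis
      using k(2) by (intro exI[of _ "X k"] exI[of _ x]) simp
  qed
  then obtain y x where yx: "\<And>n. x n \<in> K" "\<And>n. y n \<le> g (x n)" "\<And>n. ereal (f (x n)) \<le> c"
      "\<And>n. dist (y n) s < inverse (real (Suc n))"
    by metis
  have "(\<lambda>n. dist (y n) s) \<longlonglongrightarrow> 0"
    by (rule Lim_null_comparison[OF _ LIMSEQ_inverse_real_of_nat])
      (use yx(4) in \<open>simp add: less_imp_le\<close>)
  then have "y \<longlonglongrightarrow> s"
    by (rule tendsto_dist_iff[THEN iffD2])
  then obtain l where "s \<le> g l" "ereal (f l) \<le> c"
    by (rule exists_feasible_limit[OF usc lsc \<open>compact K\<close> _ yx(1-3)])
  then have "?F s \<le> c"
    unfolding constrained_inf_def by (intro INF_lower2) auto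
  with c(2) show False by simp
qed

theorem theorem3:
  fixes f g :: "real ^ 'd \<Rightarrow> real"
  assumes "upper_semicontinuous (\<lambda>x. ereal (g x))"
    and "(SUP x. ereal (g x)) < \<infinity> \<Longrightarrow> \<exists>x. ereal (g x) = (SUP y. ereal (g y))"
    and "\<exists>C :: real \<Rightarrow> (real ^ 'd) set. (\<forall>t. compact (C t)) \<and>
      (\<forall>s t. (INF x. ereal (g x)) < ereal s \<longrightarrow> s \<le> t \<longrightarrow> ereal t \<le> (SUP x. ereal (g x)) \<longrightarrow>
        constrained_inf f g s = (INF x\<in>{x \<in> C t. s \<le> g x}. ereal (f x)))"
    and "lower_semicontinuous (\<lambda>x. ereal (f x))"
  shows "lower_semicontinuous (constrained_inf f g)"
  unfolding lower_semicontinuous_def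
proof (intro allI impI)
  fix s :: real and X :: "nat \<Rightarrow> real"
  assume X: "X \<longlonglongrightarrow> s"
  consider "ereal s \<le> (INF x. ereal (g x))" | "(SUP x. ereal (g x)) < ereal s"
    | "(INF x. ereal (g x)) < ereal s" "ereal s \<le> (SUP x. ereal (g x))"
    by (meson not_le)
  then show "constrained_inf f g s \<le> liminf (\<lambda>k. constrained_inf f g (X k))"
  proof cases
    case 1
    then show ?thesis
      by (intro Liminf_bounded always_eventually allI constrained_inf_below_Inf)
  next
    case 2
    \<comment> \<open>Exceeding the supremum is an open condition on the level, so it passes to
      \<open>X k\<close> eventually, and both values are then infinite.\<close>
    then have "\<forall>\<^sub>F k in sequentially. (SUP x. ereal (g x)) < ereal (X k)"
      by (rule order_tendstoD(1)[OF tendsto_ereal[OF X]])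
    then have "\<forall>\<^sub>F k in sequentially. constrained_inf f g s \<le> constrained_inf f g (X k)"
      by eventually_elim (simp add: constrained_inf_above_Sup)
    then show ?thesis
      by (rule Liminf_bounded)
  next
    case 3
    \<comment> \<open>Fixing the argument of \<open>C\<close> at \<open>s\<close> is allowed for
      every level \<open>t\<close> in question, since \<open>t \<le> s\<close> and \<open>s\<close>
      is at most the supremum of \<open>g\<close>.\<close>
    obtain C :: "real \<Rightarrow> (real ^ 'd) set" where "compact (C s)"
      and C: "\<And>t. (INF x. ereal (g x)) < ereal t \<Longrightarrow> t \<le> s \<Longrightarrow>
        constrained_inf f g t = (INF x\<in>{x \<in> C s. t \<le> g x}. ereal (f x))"
      using assms(3) 3(2) by blast
    show ?thesis
      by (rule constrained_inf_le_liminf[OF assms(1,4) \<open>compact (C s)\<close> X 3(1) C])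
  qed
qed

end
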